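(* Let $E\mathbf{SR}$ be the e-variety of all locally inverse semigroups $S$ whose idempotent generated subsemigroup $\langle E(S)\rangle$ is strict regular. Then $E\mathbf{SR}$ has no finite basis for its bi-identities.
   Context: A semigroup $S$ is regular if for each $x\in S$ there is $x'\in S$ with $xx'x=x$; $E(S)$ is its set of idempotents. For $e,f\in E(S)$ put $e\le_{\mathcal{R}}f$ iff $e=fe$, $e\le_{\mathcal{L}}f$ iff $e=ef$, and ${\le}={\le_{\mathcal{R}}}\cap{\le_{\mathcal{L}}}$. A locally inverse semigroup is a regular semigroup such that for any idempotents $e,f$ there is an idempotent $g$ with $\{h\in E(S): h\le_{\mathcal{R}}e\}\cap\{h\in E(S):h\le_{\mathcal{L}}f\}=\{h\in E(S):h\le g\}$; this unique $g$ is denoted $e\wedge f$. The operation $\wedge$ extends to all of $S$: for $x,y\in S$, $x\wedge y$ is the unique element of $xV(yx)y$, where $V(a)$ denotes the set of all inverses of $a$ (elements $b$ with $aba=a$, $bab=b$). A regular semigroup is strict regular if it is a subdirect product of completely simple and completely $0$-simple semigroups. An e-variety of regular semigroups is a class of regular semigroups closed under homomorphic images, regular subsemigroups and direct products. Bi-identities: let $X$ be a countably infinite set of variables and $X'=\{x'\mid x\in X\}$ a disjoint copy of $X$. A bi-identity is a formal equality $u\approx v$ of two terms $u,v$ over $X\cup X'$ in the two binary operations $\cdot$ and $\wedge$ (with $\cdot$ associative). A locally inverse semigroup $S$ satisfies $u\approx v$ if $u\vartheta=v\vartheta$ in $(S,\cdot,\wedge)$ for each assignment $\vartheta:X\cup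 X'\to S$ for which $x'\vartheta$ is an inverse of $x\vartheta$ for every $x\in X$. A set $B$ of bi-identities is a basis for the bi-identities of an e-variety $\mathbf{V}$ of locally inverse semigroups if $\mathbf{V}$ is exactly the class of all locally inverse semigroups satisfying all members of $B$. *)

theory Defs
  imports "HOL-Algebra.Congruence"
begin

section \<open>Regular and locally inverse semigroups\<close>

record 'a semigrp = "'a partial_object" +
  smult :: "'a \<Rightarrow> 'a \<Rightarrow> 'a" (infixl \<open>\<cdot>\<index>\<close> 70)

definition is_semigroup :: "'a semigrp \<Rightarrow> bool" where
  "is_semigroup S \<longleftrightarrow> carrier S \<noteq> {} \<and>
     (\<forall>x\<in>carrier S. \<forall>y\<in>carrier S. x \<cdot>\<^bsub>S\<^esub> y \<in> carrier S) \<and>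
     (\<forall>x\<in>carrier S. \<forall>y\<in>carrier S. \<forall>z\<in>carrier S.
        (x \<cdot>\<^bsub>S\<^esub> y) \<cdot>\<^bsub>S\<^esub> z = x \<cdot>\<^bsub>S\<^esub> (y \<cdot>\<^bsub>S\<^esub> z))"

definition regular_semigroup :: "'a semigrp \<Rightarrow> bool" where
  "regular_semigroup S \<longleftrightarrow> is_semigroup S \<and>
     (\<forall>x\<in>carrier S. \<exists>x'\<in>carrier S. x \<cdot>\<^bsub>S\<^esub> x' \<cdot>\<^bsub>S\<^esub> x = x)"

definition idempotents :: "'a semigrp \<Rightarrow> 'a set" where
  "idempotents S = {e \<in> carrier S. e \<cdot>\<^bsub>S\<^esub> e = e}"

definition inverses :: "'a semigrp \<Rightarrow> 'a \<Rightarrow> 'a set" where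
  "inverses S a = {b \<in> carrier S. a \<cdot>\<^bsub>S\<^esub> b \<cdot>\<^bsub>S\<^esub> a = a \<and> b \<cdot>\<^bsub>S\<^esub> a \<cdot>\<^bsub>S\<^esub> b = b}"

text \<open>The following three relations are meant for idempotents only.\<close>

definition leR :: "'a semigrp \<Rightarrow> 'a \<Rightarrow> 'a \<Rightarrow> bool" where
  "leR S e f \<longleftrightarrow> e = f \<cdot>\<^bsub>S\<^esub> e"

definition leL :: "'a semigrp \<Rightarrow> 'a \<Rightarrow> 'a \<Rightarrow> bool" where
  "leL S e f \<longleftrightarrow> e = e \<cdot>\<^bsub>S\<^esub> f"

definition leE :: "'a semigrp \<Rightarrow> 'a \<Rightarrow> 'a \<Rightarrow> bool" where
  "leE S e f \<longleftrightarrow> leR S e f \<and> leL S e f"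

definition locally_inverse :: "'a semigrp \<Rightarrow> bool" where
  "locally_inverse S \<longleftrightarrow> regular_semigroup S \<and>
     (\<forall>e\<in>idempotents S. \<forall>f\<in>idempotents S. \<exists>g\<in>idempotents S.
        {h \<in> idempotents S. leR S h e} \<inter> {h \<in> idempotents S. leL S h f}
          = {h \<in> idempotents S. leE S h g})"

text \<open>In a locally inverse semigroup the set \<open>x V(y x) y\<close> is a singleton.\<close>

definition meet :: "'a semigrp \<Rightarrow> 'a \<Rightarrow> 'a \<Rightarrow> 'a" where
  "meet S x y = (THE z. z \<in> {x \<cdot>\<^bsub>S\<^esub> w \<cdot>\<^bsub>S\<^esub> y | w. w \<in> inverses S (y \<cdot>\<^bsub>S\<^esub> x)})"


section \<open>Strict regular semigroups\<close>

definition is_ideal :: "'a semigrp \<Rightarrow> 'a set \<Rightarrow> bool" where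
  "is_ideal S I \<longleftrightarrow> I \<noteq> {} \<and> I \<subseteq> carrier S \<and>
     (\<forall>s\<in>carrier S. \<forall>a\<in>I. s \<cdot>\<^bsub>S\<^esub> a \<in> I \<and> a \<cdot>\<^bsub>S\<^esub> s \<in> I)"

definition completely_simple :: "'a semigrp \<Rightarrow> bool" where
  "completely_simple S \<longleftrightarrow> is_semigroup S \<and>
     (\<forall>I. is_ideal S I \<longrightarrow> I = carrier S) \<and>
     (\<exists>e\<in>idempotents S. \<forall>f\<in>idempotents S. leE S f e \<longrightarrow> f = e)"

definition completely_zero_simple :: "'a semigrp \<Rightarrow> bool" where
  "completely_zero_simple S \<longleftrightarrow> is_semigroup S \<and>
     (\<exists>z\<in>carrier S.
        (\<forall>x\<in>carrier S. z \<cdot>\<^bsub>S\<^esub> x = z \<and> x \<cdot>\<^bsub>S\<^esub> z = z) \<and>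
        (\<exists>x\<in>carrier S. \<exists>y\<in>carrier S. x \<cdot>\<^bsub>S\<^esub> y \<noteq> z) \<and>
        (\<forall>I. is_ideal S I \<longrightarrow> I = {z} \<or> I = carrier S) \<and>
        (\<exists>e\<in>idempotents S. e \<noteq> z \<and>
           (\<forall>f\<in>idempotents S. f \<noteq> z \<and> leE S f e \<longrightarrow> f = e)))"

definition semigrp_hom :: "'a semigrp \<Rightarrow> 'b semigrp \<Rightarrow> ('a \<Rightarrow> 'b) set" where
  "semigrp_hom S T = {h. (\<forall>x\<in>carrier S. h x \<in> carrier T) \<and>
     (\<forall>x\<in>carrier S. \<forall>y\<in>carrier S. h (x \<cdot>\<^bsub>S\<^esub> y) = h x \<cdot>\<^bsub>T\<^esub> h y)}"

definition direct_product :: "'i set \<Rightarrow> ('i \<Rightarrow> 'b semigrp) \<Rightarrow> ('i \<Rightarrow> 'b) semigrp" where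
  "direct_product I T = \<lparr>carrier = (\<Pi>\<^sub>E i\<in>I. carrier (T i)),
     smult = (\<lambda>x y. \<lambda>i\<in>I. x i \<cdot>\<^bsub>T i\<^esub> y i)\<rparr>"

definition subdirect_product_of :: "'a semigrp \<Rightarrow> 'i set \<Rightarrow> ('i \<Rightarrow> 'b semigrp) \<Rightarrow> bool" where
  "subdirect_product_of S I T \<longleftrightarrow>
     (\<exists>\<phi>\<in>semigrp_hom S (direct_product I T). inj_on \<phi> (carrier S) \<and>
        (\<forall>i\<in>I. (\<lambda>s. \<phi> s i) ` carrier S = carrier (T i)))"

text \<open>The index type and the type of the factors have to be fixed here. The choice
  is no restriction: see \<open>strict_regularI\<close> below.\<close>

definition strict_regular :: "'a semigrp \<Rightarrow> bool" where
  "strict_regular S \<longleftrightarrow> regular_semigroup S \<and>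
     (\<exists>(I :: ('a \<times> 'a) set) (T :: 'a \<times> 'a \<Rightarrow> 'a semigrp).
        (\<forall>i\<in>I. completely_simple (T i) \<or> completely_zero_simple (T i)) \<and>
        subdirect_product_of S I T)"

lemma semigrp_iso_transfer:
  fixes T :: "'a semigrp" and g :: "'a \<Rightarrow> 'b"
  defines "U \<equiv> \<lparr>carrier = g ` carrier T,
      smult = (\<lambda>x y. g (inv_into (carrier T) g x \<cdot>\<^bsub>T\<^esub> inv_into (carrier T) g y))\<rparr>"
  assumes inj: "inj_on g (carrier T)"
    and T: "completely_simple T \<or> completely_zero_simple T"
  shows "completely_simple U \<or> completely_zero_simple U"
proof -
  have sT: "is_semigroup T"
    using T by (auto simp: completely_simple_def completely_zero_simple_def)
  have cl: "x \<cdot>\<^bsub>T\<^esub> y \<in> carrier T" if "x \<in> carrier T" "y \<in> carrier T" for x y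
    using sT that by (simp add: is_semigroup_def)
  have cU: "carrier U = g ` carrier T"
    by (simp add: U_def)
  have mU: "g x \<cdot>\<^bsub>U\<^esub> g y = g (x \<cdot>\<^bsub>T\<^esub> y)" if "x \<in> carrier T" "y \<in> carrier T" for x y
    using that inj by (simp add: U_def inv_into_f_f)
  have geq: "g x = g y \<longleftrightarrow> x = y" if "x \<in> carrier T" "y \<in> carrier T" for x y
    using that inj by (auto dest: inj_onD)
  have sU: "is_semigroup U"
    using sT by (auto simp: is_semigroup_def cU mU)
  have eU: "idempotents U = g ` idempotents T"
    by (auto simp: idempotents_def cU mU geq cl)
  have eT: "e \<in> carrier T" if "e \<in> idempotents T" for e
    using that by (simp add: idempotents_def)
  have leU: "leE U (g e) (g f) \<longleftrightarrow> leE T e f" if "e \<in> carrier T" "f \<in> carrier T" for e f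
    using that by (simp add: leE_def leR_def leL_def mU geq cl)
  have ideal: "\<exists>J. is_ideal T J \<and> I = g ` J" if I: "is_ideal U I" for I
  proof -
    have IU: "I \<subseteq> g ` carrier T"
      using I by (simp add: is_ideal_def cU)
    define J where "J = {x \<in> carrier T. g x \<in> I}"
    have IJ: "I = g ` J"
      using IU by (auto simp: J_def)
    have "is_ideal T J"
      unfolding is_ideal_def
    proof (intro conjI ballI)
      show "J \<noteq> {}" using I IJ by (auto simp: is_ideal_def)
      show "J \<subseteq> carrier T" by (auto simp: J_def)
    next
      fix s a assume s: "s \<in> carrier T" and a: "a \<in> J"
      have aT: "a \<in> carrier T" and aI: "g a \<in> I"
        using a by (auto simp: J_def)
      have "g s \<cdot>\<^bsub>U\<^esub> g a \<in> I \<and> g a \<cdot>\<^bsub>U\<^esub> g s \<in> I"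
        using I s aI by (auto simp: is_ideal_def cU)
      then show "s \<cdot>\<^bsub>T\<^esub> a \<in> J" "a \<cdot>\<^bsub>T\<^esub> s \<in> J"
        using s aT by (auto simp: J_def mU cl)
    qed
    with IJ show ?thesis by blast
  qed
  show ?thesis
    using T
  proof
    assume cs: "completely_simple T"
    have "I = carrier U" if "is_ideal U I" for I
      using ideal[OF that] cs by (auto simp: completely_simple_def cU)
    moreover have "\<exists>e\<in>idempotents U. \<forall>f\<in>idempotents U. leE U f e \<longrightarrow> f = e"
    proof -
      obtain e where e: "e \<in> idempotents T"
        "\<And>f. f \<in> idempotents T \<Longrightarrow> leE T f e \<Longrightarrow> f = e"
        using cs by (auto simp: completely_simple_def)
      then show ?thesis
        by (auto simp: eU leU eT)
    qed
    ultimately show ?thesis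
      using sU by (simp add: completely_simple_def)
  next
    assume "completely_zero_simple T"
    then have "\<exists>z\<in>carrier T.
        (\<forall>x\<in>carrier T. z \<cdot>\<^bsub>T\<^esub> x = z \<and> x \<cdot>\<^bsub>T\<^esub> z = z) \<and>
        (\<exists>x\<in>carrier T. \<exists>y\<in>carrier T. x \<cdot>\<^bsub>T\<^esub> y \<noteq> z) \<and>
        (\<forall>I. is_ideal T I \<longrightarrow> I = {z} \<or> I = carrier T) \<and>
        (\<exists>e\<in>idempotents T. e \<noteq> z \<and>
           (\<forall>f\<in>idempotents T. f \<noteq> z \<and> leE T f e \<longrightarrow> f = e))"
      unfolding completely_zero_simple_def by (rule conjunct2)
    then obtain z where z: "z \<in> carrier T"
      and zero: "\<forall>x\<in>carrier T. z \<cdot>\<^bsub>T\<^esub> x = z \<and> x \<cdot>\<^bsub>T\<^esub> z = z"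
      and nz: "\<exists>x\<in>carrier T. \<exists>y\<in>carrier T. x \<cdot>\<^bsub>T\<^esub> y \<noteq> z"
      and id: "\<forall>I. is_ideal T I \<longrightarrow> I = {z} \<or> I = carrier T"
      and ex: "\<exists>e\<in>idempotents T. e \<noteq> z \<and>
           (\<forall>f\<in>idempotents T. f \<noteq> z \<and> leE T f e \<longrightarrow> f = e)"
      by (rule bexE) (elim conjE, rule that)
    from ex obtain e where e: "e \<in> idempotents T" "e \<noteq> z"
      and pe: "\<forall>f\<in>idempotents T. f \<noteq> z \<and> leE T f e \<longrightarrow> f = e"
      by blast
    have "g z \<in> carrier U" using z by (simp add: cU)
    moreover have "\<forall>x\<in>carrier U. g z \<cdot>\<^bsub>U\<^esub> x = g z \<and> x \<cdot>\<^bsub>U\<^esub> g z = g z"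
      using z zero by (simp add: cU mU)
    moreover have "\<exists>x\<in>carrier U. \<exists>y\<in>carrier U. x \<cdot>\<^bsub>U\<^esub> y \<noteq> g z"
      using nz z by (simp add: cU mU geq cl)
    moreover have "\<forall>I. is_ideal U I \<longrightarrow> I = {g z} \<or> I = carrier U"
      using ideal id by (fastforce simp: cU)
    moreover have "\<exists>e\<in>idempotents U. e \<noteq> g z \<and>
           (\<forall>f\<in>idempotents U. f \<noteq> g z \<and> leE U f e \<longrightarrow> f = e)"
    proof (rule bexI[of _ "g e"], intro conjI ballI impI)
      show "g e \<in> idempotents U" "g e \<noteq> g z"
        using e z by (auto simp: eU geq eT)
    next
      fix f assume "f \<in> idempotents U" "f \<noteq> g z \<and> leE U f (g e)"
      then show "f = g e"
        using e z pe by (auto simp: eU geq leU eT)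
    qed
    ultimately have "completely_zero_simple U"
      unfolding completely_zero_simple_def
      by - (rule conjI[OF sU], rule bexI[of _ "g z"], (rule conjI, assumption)+, assumption+)
    then show ?thesis ..
  qed
qed

lemma strict_regularI:
  fixes S :: "'a semigrp" and I :: "'i set" and T :: "'i \<Rightarrow> 'b semigrp"
  assumes reg: "regular_semigroup S"
    and T: "\<And>i. i \<in> I \<Longrightarrow> completely_simple (T i) \<or> completely_zero_simple (T i)"
    and sub: "subdirect_product_of S I T"
  shows "strict_regular S"
proof -
  obtain \<phi> where hom: "\<phi> \<in> semigrp_hom S (direct_product I T)"
    and inj: "inj_on \<phi> (carrier S)"
    and onto: "\<And>i. i \<in> I \<Longrightarrow> (\<lambda>s. \<phi> s i) ` carrier S = carrier (T i)"
    using sub by (auto simp: subdirect_product_of_def)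
  have clS: "x \<cdot>\<^bsub>S\<^esub> y \<in> carrier S" if "x \<in> carrier S" "y \<in> carrier S" for x y
    using reg that by (simp add: regular_semigroup_def is_semigroup_def)
  have \<phi>E: "\<phi> x \<in> (\<Pi>\<^sub>E i\<in>I. carrier (T i))" if "x \<in> carrier S" for x
    using hom that by (simp add: semigrp_hom_def direct_product_def)
  have \<phi>m: "\<phi> (x \<cdot>\<^bsub>S\<^esub> y) i = \<phi> x i \<cdot>\<^bsub>T i\<^esub> \<phi> y i"
    if "x \<in> carrier S" "y \<in> carrier S" "i \<in> I" for x y i
    using hom that by (simp add: semigrp_hom_def direct_product_def)
  define J where "J = {(a, b). a \<in> carrier S \<and> b \<in> carrier S \<and> a \<noteq> b}"
  have "\<exists>i\<in>I. \<phi> (fst p) i \<noteq> \<phi> (snd p) i" if "p \<in> J" for p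
  proof (rule ccontr)
    assume neg: "\<not> ?thesis"
    have p: "fst p \<in> carrier S" "snd p \<in> carrier S" "fst p \<noteq> snd p"
      using that by (auto simp: J_def)
    have "\<phi> (fst p) = \<phi> (snd p)"
      using PiE_ext[OF \<phi>E[OF p(1)] \<phi>E[OF p(2)]] neg by blast
    then show False using inj p by (auto dest: inj_onD)
  qed
  then obtain c where c: "\<And>p. p \<in> J \<Longrightarrow> c p \<in> I"
    and sep: "\<And>p. p \<in> J \<Longrightarrow> \<phi> (fst p) (c p) \<noteq> \<phi> (snd p) (c p)"
    by metis
  define g where "g p = inv_into (carrier S) (\<lambda>s. \<phi> s (c p))" for p
  define U where "U p = \<lparr>carrier = g p ` carrier (T (c p)),
      smult = (\<lambda>x y. g p (inv_into (carrier (T (c p))) (g p) x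
        \<cdot>\<^bsub>T (c p)\<^esub> inv_into (carrier (T (c p))) (g p) y))\<rparr>" for p
  have gi: "inj_on (g p) (carrier (T (c p)))" if "p \<in> J" for p
    using inj_on_inv_into[of "carrier (T (c p))" "\<lambda>s. \<phi> s (c p)" "carrier S"]
      onto[OF c[OF that]] by (simp add: g_def)
  have \<phi>T: "\<phi> x (c p) \<in> carrier (T (c p))" if "x \<in> carrier S" "p \<in> J" for x p
    using \<phi>E[OF that(1)] c[OF that(2)] by (rule PiE_mem)
  define \<psi> where "\<psi> s = (\<lambda>p\<in>J. g p (\<phi> s (c p)))" for s
  have UT: "completely_simple (U p) \<or> completely_zero_simple (U p)" if "p \<in> J" for p
    unfolding U_def by (rule semigrp_iso_transfer[OF gi[OF that] T[OF c[OF that]]])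
  have "\<psi> \<in> semigrp_hom S (direct_product J U)"
    using \<phi>T gi c by (auto simp: semigrp_hom_def direct_product_def \<psi>_def U_def
        inv_into_f_f \<phi>m fun_eq_iff restrict_def PiE_def extensional_def)
  moreover have "inj_on \<psi> (carrier S)"
  proof (rule inj_onI, rule ccontr)
    fix a b assume ab: "a \<in> carrier S" "b \<in> carrier S" "\<psi> a = \<psi> b" "a \<noteq> b"
    have p: "(a, b) \<in> J" using ab by (simp add: J_def)
    have "g (a, b) (\<phi> a (c (a, b))) = g (a, b) (\<phi> b (c (a, b)))"
      using fun_cong[OF ab(3), of "(a, b)"] p by (simp add: \<psi>_def)
    then show False
      using gi[OF p] \<phi>T[OF ab(1) p] \<phi>T[OF ab(2) p] sep[OF p] by (auto dest: inj_onD)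
  qed
  moreover have "(\<lambda>s. \<psi> s p) ` carrier S = carrier (U p)" if "p \<in> J" for p
  proof -
    have "(\<lambda>s. \<psi> s p) ` carrier S = g p ` ((\<lambda>s. \<phi> s (c p)) ` carrier S)"
      using that by (simp add: \<psi>_def image_image)
    also have "\<dots> = carrier (U p)"
      using onto[OF c[OF that]] by (simp add: U_def)
    finally show ?thesis .
  qed
  ultimately have "subdirect_product_of S J U"
    unfolding subdirect_product_of_def by (intro bexI[of _ \<psi>] conjI ballI)
  moreover have "\<forall>p\<in>J. completely_simple (U p) \<or> completely_zero_simple (U p)"
    using UT by (intro ballI)
  ultimately show ?thesis
    unfolding strict_regular_def by (intro conjI[OF reg] exI[of _ J] exI[of _ U] conjI)
qed


section \<open>The e-variety \<open>ESR\<close>\<close>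

inductive_set idem_gen :: "'a semigrp \<Rightarrow> 'a set" for S :: "'a semigrp" where
  idem: "e \<in> idempotents S \<Longrightarrow> e \<in> idem_gen S"
| mult: "x \<in> idem_gen S \<Longrightarrow> y \<in> idem_gen S \<Longrightarrow> x \<cdot>\<^bsub>S\<^esub> y \<in> idem_gen S"

definition idem_gen_subsemigroup :: "'a semigrp \<Rightarrow> 'a semigrp" where
  "idem_gen_subsemigroup S = S\<lparr>carrier := idem_gen S\<rparr>"

text \<open>A class of semigroups is represented by its members with carrier in a type \<open>'a\<close>.
  If a set of bi-identities is a basis for the whole class, then it is a basis in this
  sense for every \<open>'a\<close>. Hence the absence of a finite basis over a single type \<open>'a\<close>
  implies its absence for the class. Over a finite type the notion degenerates,
  because only finitely many semigroups up to isomorphism are seen.\<close>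

definition ESR :: "'a semigrp set" where
  "ESR = {S. locally_inverse S \<and> strict_regular (idem_gen_subsemigroup S)}"


section \<open>Bi-identities\<close>

datatype letter = Var nat | Var' nat

text \<open>Terms are not identified modulo associativity of the multiplication. Since this
  multiplication is interpreted by an associative operation, and since each class of
  terms modulo associativity has a representative, this does not affect the existence
  of finite bases.\<close>

datatype bi_term = Letter letter | Mult bi_term bi_term | Meet bi_term bi_term

type_synonym bi_identity = "bi_term \<times> bi_term"

primrec eval_term :: "'a semigrp \<Rightarrow> (letter \<Rightarrow> 'a) \<Rightarrow> bi_term \<Rightarrow> 'a" where
  "eval_term S \<theta> (Letter l) = \<theta> l"
| "eval_term S \<theta> (Mult s t) = eval_term S \<theta> s \<cdot>\<^bsub>S\<^esub> eval_term S \<theta> t"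
| "eval_term S \<theta> (Meet s t) = meet S (eval_term S \<theta> s) (eval_term S \<theta> t)"

definition admissible_assignment :: "'a semigrp \<Rightarrow> (letter \<Rightarrow> 'a) \<Rightarrow> bool" where
  "admissible_assignment S \<theta> \<longleftrightarrow>
     (\<forall>n. \<theta> (Var n) \<in> carrier S \<and> \<theta> (Var' n) \<in> inverses S (\<theta> (Var n)))"

definition satisfies :: "'a semigrp \<Rightarrow> bi_identity \<Rightarrow> bool" where
  "satisfies S b \<longleftrightarrow>
     (\<forall>\<theta>. admissible_assignment S \<theta> \<longrightarrow> eval_term S \<theta> (fst b) = eval_term S \<theta> (snd b))"

definition bi_basis :: "bi_identity set \<Rightarrow> 'a semigrp set \<Rightarrow> bool" where
  "bi_basis B \<V> \<longleftrightarrow> \<V> = {S. locally_inverse S \<and> (\<forall>b\<in>B. satisfies S b)}"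

end

theory Submission
  imports Defs "HOL-Library.Countable"
begin

text \<open>In a strict regular semigroup two distinct \<open>\<D>\<close>-related idempotents never lie below a
  common idempotent: in each completely (0-)simple factor the nonzero idempotents are
  primitive, so the images of both idempotents are zero or both coincide with the image of the
  common upper bound. In the core of a locally inverse semigroup this obstruction
  may be visible only along arbitrarily long products of idempotents, whereas a bi-identity in
  \<open>k\<close> variables is evaluated in a subsemigroup generated by few elements.

  The semigroups realising this are Rees matrix semigroups over the trivial group, with one more
  idempotent \<open>Top\<close>. Their rows and columns are the natural numbers, and the sandwich matrix is the
  adjacency matrix of the path

  row 0 -- column 0 -- row 1 -- column 1 -- row 2 -- column 2 -- \<open>\<dots>\<close>

  so that \<open>Cell i l\<close> is idempotent iff row \<open>i\<close> and column \<open>l\<close> are neighbours, and it is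
  a product of idempotents iff \<open>i\<close> and \<open>l\<close> are connected. The idempotents below
  \<open>Top\<close> are \<open>Cell 0 0\<close> and \<open>Cell N N\<close>, besides zero and \<open>Top\<close> itself. The path
  from row 0 to column \<open>N\<close> makes them \<open>\<D>\<close>-related in the core, so the
  semigroup is not in \<open>ESR\<close> (\<open>full_path_not_ESR\<close>).

  If a row \<open>m\<close> strictly between 0 and \<open>N\<close> is deleted, the path falls into two pieces, each of
  which contains only one of the two idempotents. The core of the remaining locally inverse
  subsemigroup is a subdirect product of the completely 0-simple semigroups of the two
  pieces, where \<open>Top\<close> becomes \<open>Cell 0 0\<close> in one and \<open>Cell N N\<close> in the other
  (\<open>path_without_row_ESR\<close>).

  If a finite set of bi-identities with \<open>k\<close> variables in total were a basis, take \<open>N > 2 * k + 1\<close>.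
  The values of an assignment occupy at most \<open>2 * k\<close> rows, so they all lie in a subsemigroup
  with some inner row deleted. That subsemigroup is in \<open>ESR\<close>, hence satisfies the bi-identities,
  and its operation \<open>\<and>\<close> is the restricted one (\<open>satisfies_locally\<close>). So the
  whole semigroup satisfies the basis without being in \<open>ESR\<close>.\<close>

section \<open>Idempotents of strict regular semigroups\<close>

text \<open>The set \<open>Z\<close> stands for \<open>{}\<close> or \<open>{0}\<close>, which treats simple and 0-simple
  semigroups together. By simplicity \<open>g = c \<cdot> d\<close> with \<open>d \<cdot> c\<close> an idempotent below the given
  primitive \<open>e\<close>. Any nonzero idempotent \<open>h\<close> below \<open>g\<close> is recovered from \<open>d \<cdot> h \<cdot> c\<close>, which is
  a nonzero idempotent below \<open>e\<close> and so equals \<open>e\<close>; therefore all these \<open>h\<close> coincide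
  with \<open>c \<cdot> e \<cdot> d\<close>.\<close>

lemma simple_idempotents_primitive:
  assumes S: "is_semigroup S"
    and ideals: "\<And>I. is_ideal S I \<Longrightarrow> I \<subseteq> Z \<or> I = carrier S"
    and Z: "\<And>s z. s \<in> carrier S \<Longrightarrow> z \<in> Z \<Longrightarrow> s \<cdot>\<^bsub>S\<^esub> z \<in> Z \<and> z \<cdot>\<^bsub>S\<^esub> s \<in> Z"
    and e: "e \<in> idempotents S" "e \<notin> Z"
    and primitive: "\<And>f. f \<in> idempotents S \<Longrightarrow> f \<notin> Z \<Longrightarrow> leE S f e \<Longrightarrow> f = e"
    and f: "f \<in> idempotents S" "f \<notin> Z"
    and g: "g \<in> idempotents S"
    and fg: "leE S f g"
  shows "f = g"
proof -
  note cl [simp] = S[unfolded is_semigroup_def, THEN conjunct2, THEN conjunct1, rule_format]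
  note assoc = S[unfolded is_semigroup_def, THEN conjunct2, THEN conjunct2, rule_format]
  have [simp]: "e \<in> carrier S" "f \<in> carrier S" "g \<in> carrier S"
    and ee: "e \<cdot>\<^bsub>S\<^esub> e = e" and ff: "f \<cdot>\<^bsub>S\<^esub> f = f" and gg: "g \<cdot>\<^bsub>S\<^esub> g = g"
    using e f g by (auto simp: idempotents_def)
  have gf: "g \<cdot>\<^bsub>S\<^esub> f = f" and fg': "f \<cdot>\<^bsub>S\<^esub> g = f"
    using fg by (auto simp: leE_def leR_def leL_def)
  have absorb: "e \<cdot>\<^bsub>S\<^esub> (e \<cdot>\<^bsub>S\<^esub> x) = e \<cdot>\<^bsub>S\<^esub> x" "f \<cdot>\<^bsub>S\<^esub> (f \<cdot>\<^bsub>S\<^esub> x) = f \<cdot>\<^bsub>S\<^esub> x"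
    "g \<cdot>\<^bsub>S\<^esub> (g \<cdot>\<^bsub>S\<^esub> x) = g \<cdot>\<^bsub>S\<^esub> x" "g \<cdot>\<^bsub>S\<^esub> (f \<cdot>\<^bsub>S\<^esub> x) = f \<cdot>\<^bsub>S\<^esub> x"
    "f \<cdot>\<^bsub>S\<^esub> (g \<cdot>\<^bsub>S\<^esub> x) = f \<cdot>\<^bsub>S\<^esub> x" if "x \<in> carrier S" for x
    using that by (simp_all add: assoc[symmetric] ee ff gg gf fg')
  define J where "J = {s \<cdot>\<^bsub>S\<^esub> e \<cdot>\<^bsub>S\<^esub> t | s t. s \<in> carrier S \<and> t \<in> carrier S}"
  have J: "s \<cdot>\<^bsub>S\<^esub> e \<cdot>\<^bsub>S\<^esub> t \<in> J" if "s \<in> carrier S" "t \<in> carrier S" for s t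
    using that unfolding J_def by blast
  have "e \<in> J"
    using J[of e e] by (simp add: ee)
  moreover have "is_ideal S J"
    unfolding is_ideal_def
  proof (intro conjI ballI)
    show "J \<noteq> {}" using \<open>e \<in> J\<close> by blast
    show "J \<subseteq> carrier S" by (auto simp: J_def)
  next
    fix u a assume u: "u \<in> carrier S" and "a \<in> J"
    then obtain s t where a: "s \<in> carrier S" "t \<in> carrier S" "a = s \<cdot>\<^bsub>S\<^esub> e \<cdot>\<^bsub>S\<^esub> t"
      unfolding J_def by blast
    have "(u \<cdot>\<^bsub>S\<^esub> s) \<cdot>\<^bsub>S\<^esub> e \<cdot>\<^bsub>S\<^esub> t \<in> J" "s \<cdot>\<^bsub>S\<^esub> e \<cdot>\<^bsub>S\<^esub> (t \<cdot>\<^bsub>S\<^esub> u) \<in> J"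
      using a u by (simp_all only: J cl)
    then show "u \<cdot>\<^bsub>S\<^esub> a \<in> J" "a \<cdot>\<^bsub>S\<^esub> u \<in> J"
      using a u by (simp_all add: assoc)
  qed
  ultimately have "J = carrier S"
    using ideals e by blast
  then have "g \<in> J"
    using \<open>g \<in> carrier S\<close> by simp
  then obtain s t where [simp]: "s \<in> carrier S" "t \<in> carrier S" and g_eq: "s \<cdot>\<^bsub>S\<^esub> e \<cdot>\<^bsub>S\<^esub> t = g"
    unfolding J_def by blast
  define c d where "c = g \<cdot>\<^bsub>S\<^esub> s \<cdot>\<^bsub>S\<^esub> e" and "d = e \<cdot>\<^bsub>S\<^esub> t \<cdot>\<^bsub>S\<^esub> g"
  have [simp]: "c \<in> carrier S" "d \<in> carrier S"
    by (simp_all add: c_def d_def)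
  have c: "g \<cdot>\<^bsub>S\<^esub> c = c" "c \<cdot>\<^bsub>S\<^esub> e = c" and d: "e \<cdot>\<^bsub>S\<^esub> d = d" "d \<cdot>\<^bsub>S\<^esub> g = d"
    by (simp_all add: c_def d_def assoc absorb ee gg)
  have cd: "c \<cdot>\<^bsub>S\<^esub> d = g"
  proof -
    have "c \<cdot>\<^bsub>S\<^esub> d = g \<cdot>\<^bsub>S\<^esub> (s \<cdot>\<^bsub>S\<^esub> e \<cdot>\<^bsub>S\<^esub> t) \<cdot>\<^bsub>S\<^esub> g"
      by (simp add: c_def d_def assoc absorb)
    then show ?thesis by (simp add: g_eq gg)
  qed
  have moved: "c \<cdot>\<^bsub>S\<^esub> e \<cdot>\<^bsub>S\<^esub> d = h"
    if h: "h \<in> idempotents S" "h \<notin> Z" "g \<cdot>\<^bsub>S\<^esub> h = h" "h \<cdot>\<^bsub>S\<^esub> g = h" for h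
  proof -
    have [simp]: "h \<in> carrier S" and hh: "h \<cdot>\<^bsub>S\<^esub> h = h"
      using h by (auto simp: idempotents_def)
    let ?k = "d \<cdot>\<^bsub>S\<^esub> h \<cdot>\<^bsub>S\<^esub> c"
    have restore: "c \<cdot>\<^bsub>S\<^esub> ?k \<cdot>\<^bsub>S\<^esub> d = h"
    proof -
      have "c \<cdot>\<^bsub>S\<^esub> ?k \<cdot>\<^bsub>S\<^esub> d = (c \<cdot>\<^bsub>S\<^esub> d) \<cdot>\<^bsub>S\<^esub> h \<cdot>\<^bsub>S\<^esub> (c \<cdot>\<^bsub>S\<^esub> d)" by (simp add: assoc)
      then show ?thesis by (simp add: cd h)
    qed
    have "?k \<cdot>\<^bsub>S\<^esub> ?k = d \<cdot>\<^bsub>S\<^esub> (h \<cdot>\<^bsub>S\<^esub> (c \<cdot>\<^bsub>S\<^esub> d) \<cdot>\<^bsub>S\<^esub> h) \<cdot>\<^bsub>S\<^esub> c" by (simp add: assoc)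
    then have "?k \<in> idempotents S"
      by (simp add: idempotents_def cd h hh)
    moreover have "?k \<notin> Z"
      using restore Z[of c ?k] Z[of d "c \<cdot>\<^bsub>S\<^esub> ?k"] h by auto
    moreover have "leE S ?k e"
      using c d by (simp add: leE_def leR_def leL_def assoc) (simp add: assoc[symmetric])
    ultimately have "?k = e" by (rule primitive)
    then show ?thesis using restore by simp
  qed
  have "g \<notin> Z" using Z[of f g] fg' f by auto
  then show ?thesis
    using moved[of f] moved[of g] f g gf fg' gg by simp
qed

lemma completely_simple_or_zero_simple_idempotents:
  assumes "completely_simple T \<or> completely_zero_simple T"
  obtains Z where "is_semigroup T" and "\<And>a b. a \<in> Z \<Longrightarrow> b \<in> Z \<Longrightarrow> a = b"
    and "\<And>s z. s \<in> carrier T \<Longrightarrow> z \<in> Z \<Longrightarrow> s \<cdot>\<^bsub>T\<^esub> z \<in> Z \<and> z \<cdot>\<^bsub>T\<^esub> s \<in> Z"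
    and "\<And>f g. f \<in> idempotents T \<Longrightarrow> g \<in> idempotents T \<Longrightarrow> f \<notin> Z \<Longrightarrow> leE T f g \<Longrightarrow> f = g"
  using assms
proof
  assume T: "completely_simple T"
  note conjs = this[unfolded completely_simple_def]
  have sg: "is_semigroup T" by (rule conjs[THEN conjunct1])
  have id: "I = carrier T" if "is_ideal T I" for I
    using conjs[THEN conjunct2, THEN conjunct1] that by blast
  obtain e where e: "e \<in> idempotents T" "\<And>f. f \<in> idempotents T \<Longrightarrow> leE T f e \<Longrightarrow> f = e"
    using conjs[THEN conjunct2, THEN conjunct2] by blast
  have prim: "f = g" if "f \<in> idempotents T" "g \<in> idempotents T" "leE T f g" for f g
    by (rule simple_idempotents_primitive[OF sg, of "{}" e]) (use id e that in blast)+
  show thesis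
    by (rule that[OF sg, of "{}"]) (simp_all add: prim)
next
  assume T: "completely_zero_simple T"
  then have sg: "is_semigroup T" unfolding completely_zero_simple_def by blast
  from T have "\<exists>z\<in>carrier T.
      (\<forall>x\<in>carrier T. z \<cdot>\<^bsub>T\<^esub> x = z \<and> x \<cdot>\<^bsub>T\<^esub> z = z) \<and>
      (\<exists>x\<in>carrier T. \<exists>y\<in>carrier T. x \<cdot>\<^bsub>T\<^esub> y \<noteq> z) \<and>
      (\<forall>I. is_ideal T I \<longrightarrow> I = {z} \<or> I = carrier T) \<and>
      (\<exists>e\<in>idempotents T. e \<noteq> z \<and> (\<forall>f\<in>idempotents T. f \<noteq> z \<and> leE T f e \<longrightarrow> f = e))"
    unfolding completely_zero_simple_def by (rule conjunct2)
  then obtain z where z: "\<forall>x\<in>carrier T. z \<cdot>\<^bsub>T\<^esub> x = z \<and> x \<cdot>\<^bsub>T\<^esub> z = z"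
    and id: "\<forall>I. is_ideal T I \<longrightarrow> I = {z} \<or> I = carrier T"
    and ex: "\<exists>e\<in>idempotents T. e \<noteq> z \<and> (\<forall>f\<in>idempotents T. f \<noteq> z \<and> leE T f e \<longrightarrow> f = e)"
    by (rule bexE) (elim conjE, rule that)
  from ex obtain e where e: "e \<in> idempotents T" "e \<noteq> z"
    and least: "\<forall>f\<in>idempotents T. f \<noteq> z \<and> leE T f e \<longrightarrow> f = e"
    by blast
  have prim: "f = g" if "f \<in> idempotents T" "g \<in> idempotents T" "f \<notin> {z}" "leE T f g" for f g
  proof (rule simple_idempotents_primitive[OF sg, of "{z}" e])
    show "I \<subseteq> {z} \<or> I = carrier T" if "is_ideal T I" for I using id that by blast
    show "s \<cdot>\<^bsub>T\<^esub> x \<in> {z} \<and> x \<cdot>\<^bsub>T\<^esub> s \<in> {z}" if "s \<in> carrier T" "x \<in> {z}" for s x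
      using z that by simp
  qed (use e least that in blast)+
  show thesis
  proof (rule that[OF sg])
    show "a = b" if "a \<in> {z}" "b \<in> {z}" for a b using that by simp
    show "s \<cdot>\<^bsub>T\<^esub> x \<in> {z} \<and> x \<cdot>\<^bsub>T\<^esub> s \<in> {z}" if "s \<in> carrier T" "x \<in> {z}" for s x
      using z that by simp
  qed (rule prim)
qed

text \<open>The factorisations \<open>f = x \<cdot> y\<close> and \<open>g = y \<cdot> x\<close> express that \<open>f\<close> and \<open>g\<close> are \<open>\<D>\<close>-related.
  In a factor this makes \<open>f\<close> zero iff \<open>g\<close> is zero, and otherwise primitivity
  identifies both with \<open>e\<close>.\<close>

lemma strict_regular_D_related_below:
  assumes S: "strict_regular S"
    and e: "e \<in> idempotents S" and f: "f \<in> idempotents S" and g: "g \<in> idempotents S"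
    and le: "leE S f e" "leE S g e"
    and xy: "x \<in> carrier S" "y \<in> carrier S" "f = x \<cdot>\<^bsub>S\<^esub> y" "g = y \<cdot>\<^bsub>S\<^esub> x"
  shows "f = g"
proof -
  obtain I and T :: "'a \<times> 'a \<Rightarrow> 'a semigrp" where
    T: "\<And>i. i \<in> I \<Longrightarrow> completely_simple (T i) \<or> completely_zero_simple (T i)"
    and "subdirect_product_of S I T"
    using S by (auto simp: strict_regular_def)
  then obtain \<phi> where hom: "\<phi> \<in> semigrp_hom S (direct_product I T)" and inj: "inj_on \<phi> (carrier S)"
    by (auto simp: subdirect_product_of_def)
  have \<phi>E: "\<phi> a \<in> (\<Pi>\<^sub>E i\<in>I. carrier (T i))" if "a \<in> carrier S" for a
    using hom that by (simp add: semigrp_hom_def direct_product_def)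
  have car: "e \<in> carrier S" "f \<in> carrier S" "g \<in> carrier S"
    using e f g by (auto simp: idempotents_def)
  have "\<phi> f i = \<phi> g i" if i: "i \<in> I" for i
  proof -
    let ?p = "\<lambda>a. \<phi> a i"
    have m: "?p (a \<cdot>\<^bsub>S\<^esub> b) = ?p a \<cdot>\<^bsub>T i\<^esub> ?p b" if "a \<in> carrier S" "b \<in> carrier S" for a b
      using hom that i by (simp add: semigrp_hom_def direct_product_def)
    have cl: "?p a \<in> carrier (T i)" if "a \<in> carrier S" for a
      using \<phi>E[OF that] i by (rule PiE_mem)
    obtain Z where sg: "is_semigroup (T i)" and one: "\<And>a b. a \<in> Z \<Longrightarrow> b \<in> Z \<Longrightarrow> a = b"
      and Z: "\<And>s z. s \<in> carrier (T i) \<Longrightarrow> z \<in> Z \<Longrightarrow> s \<cdot>\<^bsub>T i\<^esub> z \<in> Z \<and> z \<cdot>\<^bsub>T i\<^esub> s \<in> Z"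
      and prim: "\<And>a b. a \<in> idempotents (T i) \<Longrightarrow> b \<in> idempotents (T i) \<Longrightarrow> a \<notin> Z
        \<Longrightarrow> leE (T i) a b \<Longrightarrow> a = b"
      using completely_simple_or_zero_simple_idempotents[OF T[OF i]] by blast
    have assoc: "(a \<cdot>\<^bsub>T i\<^esub> b) \<cdot>\<^bsub>T i\<^esub> c = a \<cdot>\<^bsub>T i\<^esub> (b \<cdot>\<^bsub>T i\<^esub> c)"
      if "a \<in> carrier (T i)" "b \<in> carrier (T i)" "c \<in> carrier (T i)" for a b c
      using sg that by (simp add: is_semigroup_def)
    have cl2: "a \<cdot>\<^bsub>T i\<^esub> b \<in> carrier (T i)" if "a \<in> carrier (T i)" "b \<in> carrier (T i)" for a b
      using sg that by (simp add: is_semigroup_def)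
    have id: "?p a \<in> idempotents (T i)" if "a \<in> idempotents S" for a
      using that m[of a a] cl by (auto simp: idempotents_def)
    have leE: "leE (T i) (?p a) (?p e)" if "leE S a e" "a \<in> carrier S" for a
      using that car m[of a e] m[of e a] by (auto simp: leE_def leR_def leL_def)
    have down: "?p g' \<in> Z" if "?p f' \<in> Z" "f' = x' \<cdot>\<^bsub>S\<^esub> y'" "g' = y' \<cdot>\<^bsub>S\<^esub> x'"
      "x' \<in> carrier S" "y' \<in> carrier S" "g' \<in> idempotents S" for f' g' x' y'
    proof -
      have "?p g' = ?p g' \<cdot>\<^bsub>T i\<^esub> ?p g'" using id[OF that(6)] by (simp add: idempotents_def)
      also have "\<dots> = ?p y' \<cdot>\<^bsub>T i\<^esub> (?p f' \<cdot>\<^bsub>T i\<^esub> ?p x')"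
        using that(2-5) by (simp add: m cl cl2 assoc)
      finally show ?thesis using Z cl that by simp
    qed
    show ?thesis
    proof (cases "?p f \<in> Z")
      case True
      from one[OF this down[OF this xy(3,4,1,2) g]] show ?thesis .
    next
      case False
      moreover from this have "?p g \<notin> Z" using down[OF _ xy(4,3,2,1) f] by blast
      ultimately have "?p f = ?p e" "?p g = ?p e"
        using prim[OF id[OF f] id[OF e] _ leE] prim[OF id[OF g] id[OF e] _ leE] le car by blast+
      then show ?thesis by simp
    qed
  qed
  then have "\<phi> f = \<phi> g" using PiE_ext[OF \<phi>E \<phi>E] car by blast
  then show ?thesis using inj car by (auto dest: inj_onD)
qed

section \<open>The operation \<open>\<and>\<close> in regular subsemigroups\<close>

text \<open>Two elements \<open>p\<close>, \<open>q\<close> of \<open>x V(y x) y\<close> are idempotents with \<open>p q p = p\<close> and \<open>q p q = q\<close>, and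
  both lie below the idempotent \<open>g\<close> which local inverseness provides for \<open>x x'\<close> and
  \<open>y' y\<close>. Applied once more to the pairs \<open>p\<close>, \<open>g\<close> and \<open>g\<close>, \<open>q\<close>, it yields
  \<open>p q \<le> p\<close> and \<open>p q \<le> q\<close>, and then \<open>p = p q = q\<close>.\<close>

lemma meet_set_unique:
  assumes S: "locally_inverse S" and xy: "x \<in> carrier S" "y \<in> carrier S"
    and w: "w \<in> inverses S (y \<cdot>\<^bsub>S\<^esub> x)" and v: "v \<in> inverses S (y \<cdot>\<^bsub>S\<^esub> x)"
  shows "x \<cdot>\<^bsub>S\<^esub> w \<cdot>\<^bsub>S\<^esub> y = x \<cdot>\<^bsub>S\<^esub> v \<cdot>\<^bsub>S\<^esub> y"
proof -
  have reg: "regular_semigroup S" using S by (simp add: locally_inverse_def)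
  then have sg: "is_semigroup S" by (simp add: regular_semigroup_def)
  note [simp] = sg[unfolded is_semigroup_def, THEN conjunct2, THEN conjunct1, rule_format] xy
  note assoc = sg[unfolded is_semigroup_def, THEN conjunct2, THEN conjunct2, rule_format]
  have [simp]: "w \<in> carrier S" "v \<in> carrier S" using w v by (auto simp: inverses_def)
  have li: "\<exists>r\<in>idempotents S. \<forall>h\<in>idempotents S. leR S h e \<and> leL S h f \<longleftrightarrow> leE S h r"
    if "e \<in> idempotents S" "f \<in> idempotents S" for e f
  proof -
    obtain r where "r \<in> idempotents S" "{h \<in> idempotents S. leR S h e} \<inter> {h \<in> idempotents S. leL S h f}
          = {h \<in> idempotents S. leE S h r}"
      using S \<open>e \<in> idempotents S\<close> \<open>f \<in> idempotents S\<close> by (fastforce simp: locally_inverse_def)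
    then show ?thesis by blast
  qed
  define p q where "p = x \<cdot>\<^bsub>S\<^esub> w \<cdot>\<^bsub>S\<^esub> y" and "q = x \<cdot>\<^bsub>S\<^esub> v \<cdot>\<^bsub>S\<^esub> y"
  have [simp]: "p \<in> carrier S" "q \<in> carrier S" by (simp_all add: p_def q_def)
  have sandwich: "(x \<cdot>\<^bsub>S\<^esub> a \<cdot>\<^bsub>S\<^esub> y) \<cdot>\<^bsub>S\<^esub> (x \<cdot>\<^bsub>S\<^esub> b \<cdot>\<^bsub>S\<^esub> y) = x \<cdot>\<^bsub>S\<^esub> (a \<cdot>\<^bsub>S\<^esub> (y \<cdot>\<^bsub>S\<^esub> x) \<cdot>\<^bsub>S\<^esub> b) \<cdot>\<^bsub>S\<^esub> y"
    if "a \<in> carrier S" "b \<in> carrier S" for a b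
    using that by (simp add: assoc)
  have triple: "a \<cdot>\<^bsub>S\<^esub> (y \<cdot>\<^bsub>S\<^esub> x) \<cdot>\<^bsub>S\<^esub> b \<cdot>\<^bsub>S\<^esub> (y \<cdot>\<^bsub>S\<^esub> x) \<cdot>\<^bsub>S\<^esub> a = a"
    if "a \<in> inverses S (y \<cdot>\<^bsub>S\<^esub> x)" "b \<in> inverses S (y \<cdot>\<^bsub>S\<^esub> x)" for a b
  proof -
    have [simp]: "a \<in> carrier S" "b \<in> carrier S" using that by (auto simp: inverses_def)
    have "a \<cdot>\<^bsub>S\<^esub> (y \<cdot>\<^bsub>S\<^esub> x) \<cdot>\<^bsub>S\<^esub> b \<cdot>\<^bsub>S\<^esub> (y \<cdot>\<^bsub>S\<^esub> x) \<cdot>\<^bsub>S\<^esub> a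
        = a \<cdot>\<^bsub>S\<^esub> ((y \<cdot>\<^bsub>S\<^esub> x) \<cdot>\<^bsub>S\<^esub> b \<cdot>\<^bsub>S\<^esub> (y \<cdot>\<^bsub>S\<^esub> x)) \<cdot>\<^bsub>S\<^esub> a"
      by (simp add: assoc)
    then show ?thesis using that by (simp add: inverses_def)
  qed
  have pp: "p \<cdot>\<^bsub>S\<^esub> p = p" and qq: "q \<cdot>\<^bsub>S\<^esub> q = q"
    using w v by (simp_all add: p_def q_def sandwich inverses_def)
  have pqp: "p \<cdot>\<^bsub>S\<^esub> q \<cdot>\<^bsub>S\<^esub> p = p" and qpq: "q \<cdot>\<^bsub>S\<^esub> p \<cdot>\<^bsub>S\<^esub> q = q"
    using triple[OF w v] triple[OF v w] by (simp_all add: p_def q_def sandwich)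
  have "p \<cdot>\<^bsub>S\<^esub> q \<cdot>\<^bsub>S\<^esub> (p \<cdot>\<^bsub>S\<^esub> q) = p \<cdot>\<^bsub>S\<^esub> q \<cdot>\<^bsub>S\<^esub> p \<cdot>\<^bsub>S\<^esub> q" by (simp add: assoc)
  then have idem: "p \<in> idempotents S" "q \<in> idempotents S" "p \<cdot>\<^bsub>S\<^esub> q \<in> idempotents S"
    by (simp_all add: idempotents_def pp qq pqp)
  obtain x' where x': "x' \<in> carrier S" "x \<cdot>\<^bsub>S\<^esub> x' \<cdot>\<^bsub>S\<^esub> x = x"
    using reg xy unfolding regular_semigroup_def by blast
  obtain y' where y': "y' \<in> carrier S" "y \<cdot>\<^bsub>S\<^esub> y' \<cdot>\<^bsub>S\<^esub> y = y"
    using reg xy unfolding regular_semigroup_def by blast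
  have x'x: "(x \<cdot>\<^bsub>S\<^esub> x') \<cdot>\<^bsub>S\<^esub> (x \<cdot>\<^bsub>S\<^esub> a) = x \<cdot>\<^bsub>S\<^esub> a" if "a \<in> carrier S" for a
    using that x' by (simp add: assoc[of "x \<cdot>\<^bsub>S\<^esub> x'" x a, symmetric])
  have y'y: "(a \<cdot>\<^bsub>S\<^esub> y) \<cdot>\<^bsub>S\<^esub> (y' \<cdot>\<^bsub>S\<^esub> y) = a \<cdot>\<^bsub>S\<^esub> y" if "a \<in> carrier S" for a
    using that y' by (simp add: assoc)
  have "x \<cdot>\<^bsub>S\<^esub> x' \<in> idempotents S" "y' \<cdot>\<^bsub>S\<^esub> y \<in> idempotents S"
    using x' y' x'x[of x'] y'y[of y'] by (simp_all add: idempotents_def)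
  from li[OF this] obtain g where g: "g \<in> idempotents S"
    and g_iff: "\<And>h. h \<in> idempotents S \<Longrightarrow> leR S h (x \<cdot>\<^bsub>S\<^esub> x') \<and> leL S h (y' \<cdot>\<^bsub>S\<^esub> y) \<longleftrightarrow> leE S h g"
    by blast
  have below: "leE S (x \<cdot>\<^bsub>S\<^esub> a \<cdot>\<^bsub>S\<^esub> y) g" if "a \<in> carrier S" "x \<cdot>\<^bsub>S\<^esub> a \<cdot>\<^bsub>S\<^esub> y \<in> idempotents S" for a
    using that g_iff[of "x \<cdot>\<^bsub>S\<^esub> a \<cdot>\<^bsub>S\<^esub> y"] x'x[of "a \<cdot>\<^bsub>S\<^esub> y"] y'y[of "x \<cdot>\<^bsub>S\<^esub> a"]
    by (simp add: leR_def leL_def assoc)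
  have [simp]: "g \<in> carrier S" using g by (simp add: idempotents_def)
  have pg: "g \<cdot>\<^bsub>S\<^esub> p = p" "p \<cdot>\<^bsub>S\<^esub> g = p" and qg: "g \<cdot>\<^bsub>S\<^esub> q = q" "q \<cdot>\<^bsub>S\<^esub> g = q"
    using below[of w] below[of v] idem by (simp_all add: p_def[symmetric] q_def[symmetric] leE_def leR_def leL_def)
  have assoc_pq: "p \<cdot>\<^bsub>S\<^esub> (p \<cdot>\<^bsub>S\<^esub> q) = p \<cdot>\<^bsub>S\<^esub> q" "p \<cdot>\<^bsub>S\<^esub> q \<cdot>\<^bsub>S\<^esub> g = p \<cdot>\<^bsub>S\<^esub> q"
    "g \<cdot>\<^bsub>S\<^esub> (p \<cdot>\<^bsub>S\<^esub> q) = p \<cdot>\<^bsub>S\<^esub> q" "p \<cdot>\<^bsub>S\<^esub> q \<cdot>\<^bsub>S\<^esub> q = p \<cdot>\<^bsub>S\<^esub> q"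
    by (simp_all add: assoc qg qq) (simp_all add: assoc[symmetric] pp pg)
  \<comment> \<open>Both \<open>p\<close> and \<open>p q\<close> lie below the idempotent \<open>r\<close> for \<open>p\<close>, \<open>g\<close>, and \<open>r = p r = p\<close>.\<close>
  obtain r where r: "r \<in> idempotents S"
    "\<And>h. h \<in> idempotents S \<Longrightarrow> leR S h p \<and> leL S h g \<longleftrightarrow> leE S h r"
    using li[OF idem(1) g] by blast
  have "leE S p r" "leE S (p \<cdot>\<^bsub>S\<^esub> q) r" "leR S r p"
    using r(2)[of p] r(2)[of "p \<cdot>\<^bsub>S\<^esub> q"] r(2)[of r] r(1) idem assoc_pq pg pp
    by (auto simp: leE_def leR_def leL_def idempotents_def)
  then have "p \<cdot>\<^bsub>S\<^esub> q = p \<cdot>\<^bsub>S\<^esub> q \<cdot>\<^bsub>S\<^esub> p" by (auto simp: leE_def leR_def leL_def)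
  then have "p \<cdot>\<^bsub>S\<^esub> q = p" using pqp by simp
  obtain s where s: "s \<in> idempotents S"
    "\<And>h. h \<in> idempotents S \<Longrightarrow> leR S h g \<and> leL S h q \<longleftrightarrow> leE S h s"
    using li[OF g idem(2)] by blast
  have "leE S q s" "leE S (p \<cdot>\<^bsub>S\<^esub> q) s" "leL S s q"
    using s(2)[of q] s(2)[of "p \<cdot>\<^bsub>S\<^esub> q"] s(2)[of s] s(1) idem assoc_pq qg qq
    by (auto simp: leE_def leR_def leL_def idempotents_def)
  then have "p \<cdot>\<^bsub>S\<^esub> q = q \<cdot>\<^bsub>S\<^esub> (p \<cdot>\<^bsub>S\<^esub> q)" by (auto simp: leE_def leR_def leL_def)
  then have "p \<cdot>\<^bsub>S\<^esub> q = q" using qpq by (simp add: assoc)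
  with \<open>p \<cdot>\<^bsub>S\<^esub> q = p\<close> show ?thesis by (simp add: p_def q_def)
qed

lemma meet_eqI:
  assumes "locally_inverse S" "x \<in> carrier S" "y \<in> carrier S" "w \<in> inverses S (y \<cdot>\<^bsub>S\<^esub> x)"
  shows "meet S x y = x \<cdot>\<^bsub>S\<^esub> w \<cdot>\<^bsub>S\<^esub> y"
  unfolding meet_def
proof (rule the_equality)
  show "x \<cdot>\<^bsub>S\<^esub> w \<cdot>\<^bsub>S\<^esub> y \<in> {x \<cdot>\<^bsub>S\<^esub> w \<cdot>\<^bsub>S\<^esub> y |w. w \<in> inverses S (y \<cdot>\<^bsub>S\<^esub> x)}"
    using assms(4) by blast
next
  fix z assume "z \<in> {x \<cdot>\<^bsub>S\<^esub> w \<cdot>\<^bsub>S\<^esub> y |w. w \<in> inverses S (y \<cdot>\<^bsub>S\<^esub> x)}"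
  then show "z = x \<cdot>\<^bsub>S\<^esub> w \<cdot>\<^bsub>S\<^esub> y"
    using meet_set_unique[OF assms(1-3) _ assms(4)] by blast
qed

lemma regular_has_inverse:
  assumes "regular_semigroup S" "x \<in> carrier S"
  obtains w where "w \<in> inverses S x"
proof -
  obtain v where v: "v \<in> carrier S" "x \<cdot>\<^bsub>S\<^esub> v \<cdot>\<^bsub>S\<^esub> x = x"
    using assms unfolding regular_semigroup_def by blast
  have sg: "is_semigroup S" using assms by (simp add: regular_semigroup_def)
  note [simp] = sg[unfolded is_semigroup_def, THEN conjunct2, THEN conjunct1, rule_format]
  note assoc = sg[unfolded is_semigroup_def, THEN conjunct2, THEN conjunct2, rule_format]
  have x: "x \<cdot>\<^bsub>S\<^esub> (v \<cdot>\<^bsub>S\<^esub> x) = x" "\<And>a. a \<in> carrier S \<Longrightarrow> x \<cdot>\<^bsub>S\<^esub> (v \<cdot>\<^bsub>S\<^esub> (x \<cdot>\<^bsub>S\<^esub> a)) = x \<cdot>\<^bsub>S\<^esub> a"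
    using v assms by (simp_all add: assoc[symmetric])
  have "v \<cdot>\<^bsub>S\<^esub> x \<cdot>\<^bsub>S\<^esub> v \<in> inverses S x"
    using v assms x by (simp add: inverses_def assoc)
  then show ?thesis by (rule that)
qed

text \<open>An inverse of \<open>y x\<close> taken inside the subsemigroup is an inverse in the whole semigroup,
  and any inverse computes \<open>x \<and> y\<close>. Regularity of the subsemigroup supplies one.\<close>

lemma meet_subsemigroup:
  fixes S :: "'a semigrp"
  assumes S: "locally_inverse S" and T: "locally_inverse (S\<lparr>carrier := A\<rparr>)" and A: "A \<subseteq> carrier S"
    and xy: "x \<in> A" "y \<in> A"
  shows "meet (S\<lparr>carrier := A\<rparr>) x y = meet S x y \<and> meet S x y \<in> A"
proof -
  let ?T = "S\<lparr>carrier := A\<rparr>"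
  have reg: "regular_semigroup ?T" using T by (simp add: locally_inverse_def)
  have cl: "a \<cdot>\<^bsub>S\<^esub> b \<in> A" if "a \<in> A" "b \<in> A" for a b
    using reg that by (simp add: regular_semigroup_def is_semigroup_def)
  obtain w where w: "w \<in> inverses ?T (y \<cdot>\<^bsub>S\<^esub> x)"
    using regular_has_inverse[OF reg, of "y \<cdot>\<^bsub>S\<^esub> x"] cl xy by auto
  then have wS: "w \<in> inverses S (y \<cdot>\<^bsub>S\<^esub> x)" and wA: "w \<in> A"
    using A by (auto simp: inverses_def)
  show ?thesis
    using meet_eqI[OF T, of x y w] meet_eqI[OF S _ _ wS] w wA xy cl subsetD[OF A] by simp
qed

section \<open>Evaluation of bi-identities\<close>

primrec variable :: "letter \<Rightarrow> nat" where
  "variable (Var n) = n"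
| "variable (Var' n) = n"

primrec variables :: "bi_term \<Rightarrow> nat set" where
  "variables (Letter l) = {variable l}"
| "variables (Mult s t) = variables s \<union> variables t"
| "variables (Meet s t) = variables s \<union> variables t"

lemma finite_variables: "finite (variables t)"
  by (induction t) auto

lemma variables_nonempty: "variables t \<noteq> {}"
  by (induction t) auto

lemma eval_term_cong:
  "(\<And>l. variable l \<in> variables t \<Longrightarrow> \<theta> l = \<theta>' l) \<Longrightarrow> eval_term S \<theta> t = eval_term S \<theta>' t"
  by (induction t) auto

lemma eval_term_subsemigroup:
  fixes S :: "'a semigrp"
  assumes S: "locally_inverse S" and T: "locally_inverse (S\<lparr>carrier := A\<rparr>)" and A: "A \<subseteq> carrier S"
    and \<theta>: "\<And>l. \<theta> l \<in> A"
  shows "eval_term (S\<lparr>carrier := A\<rparr>) \<theta> t = eval_term S \<theta> t \<and> eval_term S \<theta> t \<in> A"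
proof (induction t)
  case (Letter l)
  then show ?case using \<theta> by simp
next
  case (Mult s t)
  then show ?case
    using T by (auto simp: locally_inverse_def regular_semigroup_def is_semigroup_def)
next
  case (Meet s t)
  then show ?case using meet_subsemigroup[OF S T A] by auto
qed

text \<open>A bi-identity depends only on the values of its own variables, so it may be checked in a
  subsemigroup chosen for each assignment. The values of the remaining letters may
  lie outside of it; they are replaced by those of some variable that does occur.\<close>

lemma satisfies_locally:
  fixes S :: "'a semigrp"
  assumes S: "locally_inverse S"
    and local: "\<And>\<theta>. admissible_assignment S \<theta> \<Longrightarrow>
      \<exists>A \<subseteq> carrier S. locally_inverse (S\<lparr>carrier := A\<rparr>) \<and> satisfies (S\<lparr>carrier := A\<rparr>) b \<and>
        (\<forall>l. variable l \<in> variables (fst b) \<union> variables (snd b) \<longrightarrow> \<theta> l \<in> A)"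
  shows "satisfies S b"
  unfolding satisfies_def
proof (intro allI impI)
  fix \<theta> assume \<theta>: "admissible_assignment S \<theta>"
  let ?V = "variables (fst b) \<union> variables (snd b)"
  obtain A where A: "A \<subseteq> carrier S" and T: "locally_inverse (S\<lparr>carrier := A\<rparr>)"
    and sat: "satisfies (S\<lparr>carrier := A\<rparr>) b"
    and V: "\<And>l. variable l \<in> ?V \<Longrightarrow> \<theta> l \<in> A"
    using local[OF \<theta>] by blast
  obtain n where n: "n \<in> ?V" using variables_nonempty[of "fst b"] by blast
  define \<theta>' where "\<theta>' l = (if variable l \<in> ?V then \<theta> l else
    case l of Var _ \<Rightarrow> \<theta> (Var n) | Var' _ \<Rightarrow> \<theta> (Var' n))" for l
  have in_A: "\<theta>' l \<in> A" for l
    using V n by (auto simp: \<theta>'_def split: letter.split)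
  have "admissible_assignment (S\<lparr>carrier := A\<rparr>) \<theta>'"
    unfolding admissible_assignment_def
  proof
    fix k
    have "\<theta>' (Var' k) \<in> inverses S (\<theta>' (Var k))"
      using \<theta> by (auto simp: \<theta>'_def admissible_assignment_def)
    then show "\<theta>' (Var k) \<in> carrier (S\<lparr>carrier := A\<rparr>) \<and>
        \<theta>' (Var' k) \<in> inverses (S\<lparr>carrier := A\<rparr>) (\<theta>' (Var k))"
      using in_A by (auto simp: inverses_def)
  qed
  then have "eval_term S \<theta>' (fst b) = eval_term S \<theta>' (snd b)"
    using sat eval_term_subsemigroup[of S A \<theta>'] S T A in_A by (metis satisfies_def)
  moreover have "eval_term S \<theta>' (fst b) = eval_term S \<theta> (fst b)"
    "eval_term S \<theta>' (snd b) = eval_term S \<theta> (snd b)"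
    by (rule eval_term_cong; simp add: \<theta>'_def)+
  ultimately show "eval_term S \<theta> (fst b) = eval_term S \<theta> (snd b)" by simp
qed

section \<open>Path semigroups\<close>

datatype element = Top | Zero | Cell nat nat

instance element :: countable
  by countable_datatype

text \<open>The argument order is column, row: this is the \<open>(l, i)\<close> entry of the sandwich matrix.\<close>

definition adjacent :: "nat \<Rightarrow> nat \<Rightarrow> bool" where
  "adjacent l i \<longleftrightarrow> i = l \<or> i = Suc l"

text \<open>Multiplication by \<open>Top\<close> is forced by the demand that \<open>Top\<close> acts as the sum of the two
  orthogonal idempotents \<open>Cell 0 0\<close> and \<open>Cell N N\<close>: the product of \<open>Top\<close> with a
  cell is the product of that cell with whichever of the two does not annihilate it. There is
  at most one such as soon as \<open>2 \<le> N\<close>.\<close>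

fun pmult :: "nat \<Rightarrow> element \<Rightarrow> element \<Rightarrow> element" where
  "pmult N Top Top = Top"
| "pmult N Top (Cell i l) =
    (if adjacent 0 i then Cell 0 l else if adjacent N i then Cell N l else Zero)"
| "pmult N (Cell i l) Top =
    (if adjacent l 0 then Cell i 0 else if adjacent l N then Cell i N else Zero)"
| "pmult N (Cell i l) (Cell j k) = (if adjacent l j then Cell i k else Zero)"
| "pmult N _ _ = Zero"

text \<open>On idempotents this is the operation \<open>\<and>\<close>. A cell that is \<open>\<le>\<^sub>\<R>\<close> below \<open>Cell i l\<close> lies in row \<open>i\<close>,
  one below \<open>Top\<close> in row 0 or \<open>N\<close>, and dually for columns. With \<open>2 \<le> N\<close> at most one
  idempotent cell meets both conditions, unless both arguments are \<open>Top\<close>.\<close>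

fun pmeet :: "nat \<Rightarrow> element \<Rightarrow> element \<Rightarrow> element" where
  "pmeet N Top Top = Top"
| "pmeet N Top (Cell i l) =
    (if adjacent l 0 then Cell 0 l else if adjacent l N then Cell N l else Zero)"
| "pmeet N (Cell i l) Top =
    (if adjacent 0 i then Cell i 0 else if adjacent N i then Cell i N else Zero)"
| "pmeet N (Cell i l) (Cell j k) = (if adjacent k i then Cell i k else Zero)"
| "pmeet N _ _ = Zero"

lemma pmult_Zero [simp]: "pmult N Zero x = Zero" "pmult N x Zero = Zero"
  by (cases x; simp)+

lemma pmult_assoc:
  assumes "2 \<le> N"
  shows "pmult N (pmult N x y) z = pmult N x (pmult N y z)"
  using assms by (cases x; cases y; cases z) (auto simp: adjacent_def)

lemma idempotent_Cell [simp]: "pmult N (Cell i l) (Cell i l) = Cell i l \<longleftrightarrow> adjacent l i"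
  by simp

lemma pmeet_idempotent: "pmult N (pmeet N u v) (pmeet N u v) = pmeet N u v"
  by (cases u; cases v) (auto simp: adjacent_def)

lemma below_Top:
  assumes "2 \<le> N"
  shows "pmult N Top h = h \<longleftrightarrow> h = Top \<or> h = Zero \<or> (\<exists>k. h = Cell 0 k \<or> h = Cell N k)"
    and "pmult N h Top = h \<longleftrightarrow> h = Top \<or> h = Zero \<or> (\<exists>j. h = Cell j 0 \<or> h = Cell j N)"
  using assms by (cases h; force simp: adjacent_def)+

lemma below_Cell:
  assumes "adjacent l i"
  shows "pmult N (Cell i l) h = h \<longleftrightarrow> h = Zero \<or> (\<exists>k. h = Cell i k)"
    and "pmult N h (Cell i l) = h \<longleftrightarrow> h = Zero \<or> (\<exists>j. h = Cell j l)"
  using assms by (cases h; auto)+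

lemma below_pmeet:
  assumes N: "2 \<le> N" and "pmult N u u = u" "pmult N v v = v" "pmult N h h = h"
  shows "pmult N u h = h \<and> pmult N h v = h \<longleftrightarrow>
    pmult N (pmeet N u v) h = h \<and> pmult N h (pmeet N u v) = h"
proof -
  have ends: "adjacent 0 0" "adjacent N N" "\<not> (adjacent l 0 \<and> adjacent l N)"
    "\<not> (adjacent 0 i \<and> adjacent N i)" for i l
    using N by (auto simp: adjacent_def)
  show ?thesis
  proof (cases u; cases v)
    fix i l j k assume "u = Cell i l" "v = Cell j k"
    then show ?thesis using assms
      by (auto simp: below_Cell simp del: pmult.simps(4))
  next
    fix j k assume "u = Top" "v = Cell j k"
    then show ?thesis using assms ends
      by (auto simp: below_Cell below_Top[OF N] simp del: pmult.simps(2-4))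
  next
    fix i l assume "u = Cell i l" "v = Top"
    then show ?thesis using assms ends
      by (auto simp: below_Cell below_Top[OF N] simp del: pmult.simps(2-4))
  qed (auto simp: eq_commute[of Zero])
qed

definition cells :: "nat set \<Rightarrow> element set" where
  "cells A = {x. \<forall>i l. x = Cell i l \<longrightarrow> i \<in> A}"

lemma cells_simps [simp]: "Top \<in> cells A" "Zero \<in> cells A" "Cell i l \<in> cells A \<longleftrightarrow> i \<in> A"
  by (auto simp: cells_def)

lemma cells_UNIV: "cells UNIV = UNIV"
  by (simp add: cells_def)

definition path_semigroup :: "(element \<Rightarrow> 'a) \<Rightarrow> nat \<Rightarrow> nat set \<Rightarrow> 'a semigrp" where
  "path_semigroup c N A = \<lparr>carrier = c ` cells A,
     smult = (\<lambda>x y. c (pmult N (inv c x) (inv c y)))\<rparr>"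

lemma carrier_path_semigroup [simp]: "carrier (path_semigroup c N A) = c ` cells A"
  by (simp add: path_semigroup_def)

lemma path_semigroup_restrict:
  "path_semigroup c N A\<lparr>carrier := c ` cells A'\<rparr> = path_semigroup c N A'"
  by (simp add: path_semigroup_def)

text \<open>The map \<open>c\<close> copies the semigroup into the given type. The condition \<open>cover\<close> says that every
  column keeps a neighbouring row, which is what regularity requires.\<close>

locale path_rows =
  fixes c :: "element \<Rightarrow> 'a" and N :: nat and A :: "nat set"
  assumes inj: "inj c" and N: "2 \<le> N"
    and ends: "0 \<in> A" "N \<in> A" and cover: "\<And>l. l \<in> A \<or> Suc l \<in> A"
begin

abbreviation "S \<equiv> path_semigroup c N A"

lemma c_eq [simp]: "c x = c y \<longleftrightarrow> x = y"
  using inj by (auto dest: injD)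

lemma c_image [simp]: "c x \<in> c ` X \<longleftrightarrow> x \<in> X"
  by auto

lemma inv_c [simp]: "inv c (c x) = x"
  using inj by simp

lemma smult_path [simp]: "c x \<cdot>\<^bsub>S\<^esub> c y = c (pmult N x y)"
  by (simp add: path_semigroup_def)

lemma pmult_cells: "x \<in> cells A \<Longrightarrow> y \<in> cells A \<Longrightarrow> pmult N x y \<in> cells A"
  using ends by (cases x; cases y) auto

lemma is_semigroup: "is_semigroup S"
  unfolding is_semigroup_def
proof (intro conjI ballI)
  have "c Top \<in> carrier S" by simp
  then show "carrier S \<noteq> {}" by blast
qed (auto simp: pmult_cells pmult_assoc[OF N])

lemma regular_semigroup: "regular_semigroup S"
  unfolding regular_semigroup_def
proof (intro conjI ballI)
  fix a assume "a \<in> carrier S"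
  then obtain x where a: "a = c x" and x: "x \<in> cells A" by auto
  have "\<exists>y\<in>cells A. pmult N (pmult N x y) x = x"
  proof (cases x)
    case (Cell i l)
    \<comment> \<open>An inverse must lie in a row adjacent to column \<open>l\<close> and a column adjacent to row \<open>i\<close>.\<close>
    then show ?thesis
      by (intro bexI[of _ "Cell (if l \<in> A then l else Suc l) i"])
        (use cover[of l] in \<open>auto simp: adjacent_def\<close>)
  qed (auto intro: bexI[of _ x] x)
  then show "\<exists>b\<in>carrier S. a \<cdot>\<^bsub>S\<^esub> b \<cdot>\<^bsub>S\<^esub> a = a" by (auto simp: a)
qed (rule is_semigroup)

lemma idempotents_path: "idempotents S = c ` {x \<in> cells A. pmult N x x = x}"
  by (auto simp: idempotents_def)

lemma le_path [simp]:
  "leR S (c x) (c y) \<longleftrightarrow> pmult N y x = x"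
  "leL S (c x) (c y) \<longleftrightarrow> pmult N x y = x"
  by (auto simp: leR_def leL_def)

lemma pmeet_cells:
  "u \<in> cells A \<Longrightarrow> v \<in> cells A \<Longrightarrow> pmeet N u v \<in> cells A"
  using ends by (cases u; cases v) auto

lemma locally_inverse: "locally_inverse S"
  unfolding locally_inverse_def
proof (intro conjI ballI regular_semigroup)
  fix e f assume "e \<in> idempotents S" "f \<in> idempotents S"
  then obtain u v where uv: "e = c u" "f = c v" "u \<in> cells A" "v \<in> cells A"
    "pmult N u u = u" "pmult N v v = v"
    by (auto simp: idempotents_path)
  let ?g = "c (pmeet N u v)"
  have "?g \<in> idempotents S"
    using uv by (simp add: idempotents_path pmeet_cells pmeet_idempotent)
  moreover have "leR S h e \<and> leL S h f \<longleftrightarrow> leE S h ?g" if h: "h \<in> idempotents S" for h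
  proof -
    obtain x where "h = c x" "pmult N x x = x"
      using h by (auto simp: idempotents_path)
    then show ?thesis
      using below_pmeet[OF N uv(5,6), of x] by (simp add: leE_def uv(1,2))
  qed
  ultimately show "\<exists>g\<in>idempotents S. {h \<in> idempotents S. leR S h e} \<inter> {h \<in> idempotents S. leL S h f}
      = {h \<in> idempotents S. leE S h g}"
    by (intro bexI[of _ ?g]) blast+
qed

lemma idempotent_in_core:
  "x \<in> cells A \<Longrightarrow> pmult N x x = x \<Longrightarrow> c x \<in> idem_gen S"
  by (rule idem_gen.idem) (auto simp: idempotents_path)

lemma core_mult: "c x \<in> idem_gen S \<Longrightarrow> c y \<in> idem_gen S \<Longrightarrow> c (pmult N x y) \<in> idem_gen S"
  using idem_gen.mult[of "c x" S "c y"] by simp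

text \<open>The next two lemmas walk along the path from row \<open>i\<close> to column \<open>l\<close>, multiplying by one
  idempotent per edge; the rows listed in the assumption are those visited on the way.\<close>

lemma core_above:
  assumes "i \<le> l" "{i..l} \<subseteq> A"
  shows "c (Cell i l) \<in> idem_gen S"
  using assms
proof (induction l rule: dec_induct)
  case base
  then show ?case by (intro idempotent_in_core) (auto simp: adjacent_def)
next
  case (step k)
  have "c (Cell (Suc k) (Suc k)) \<in> idem_gen S"
    by (intro idempotent_in_core) (use step in \<open>auto simp: adjacent_def\<close>)
  moreover have "c (Cell i k) \<in> idem_gen S"
    by (rule step.IH) (use step.prems in auto)
  ultimately show ?case
    using core_mult[of "Cell i k" "Cell (Suc k) (Suc k)"] by (simp add: adjacent_def)
qed

lemma core_below:
  assumes "l < i" "{l<..i} \<subseteq> A"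
  shows "c (Cell i l) \<in> idem_gen S"
  using assms
proof (induction l rule: strict_inc_induct)
  case (base l)
  then show ?case by (intro idempotent_in_core) (auto simp: adjacent_def)
next
  case (step l)
  have "c (Cell (Suc l) l) \<in> idem_gen S"
    by (intro idempotent_in_core) (use step in \<open>auto simp: adjacent_def\<close>)
  moreover have "c (Cell i (Suc l)) \<in> idem_gen S"
    by (rule step.IH) (use step.prems in auto)
  ultimately show ?case
    using core_mult[of "Cell i (Suc l)" "Cell (Suc l) l"] by (simp add: adjacent_def)
qed

end

text \<open>With all rows present the semigroup is its own core, and \<open>Cell 0 N\<close> and \<open>Cell N 0\<close> link the
  idempotents \<open>Cell 0 0\<close> and \<open>Cell N N\<close> below \<open>Top\<close>.\<close>

lemma full_path_not_ESR:
  fixes c :: "element \<Rightarrow> 'a"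
  assumes c: "inj c" and N: "2 \<le> N"
  shows "path_semigroup c N UNIV \<notin> ESR"
proof
  interpret path_rows c N UNIV
    by unfold_locales (use c N in auto)
  assume "S \<in> ESR"
  have "c x \<in> idem_gen S" for x
  proof (cases x)
    case (Cell i l)
    then show ?thesis using core_above[of i l] core_below[of l i] by (cases "i \<le> l") auto
  qed (auto intro: idempotent_in_core)
  moreover have "idem_gen S \<subseteq> carrier S"
  proof
    fix a assume "a \<in> idem_gen S"
    then show "a \<in> carrier S"
      by induction (use is_semigroup in \<open>auto simp: is_semigroup_def idempotents_def\<close>)
  qed
  ultimately have "idem_gen S = carrier S" by auto
  then have "idem_gen_subsemigroup S = S"
    by (simp add: idem_gen_subsemigroup_def)
  with \<open>S \<in> ESR\<close> have strict: "strict_regular S" by (simp add: ESR_def)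
  have "c (Cell 0 0) = c (Cell N N)"
  proof (rule strict_regular_D_related_below[OF strict])
    show "c Top \<in> idempotents S" "c (Cell 0 0) \<in> idempotents S" "c (Cell N N) \<in> idempotents S"
      by (auto simp: idempotents_path adjacent_def)
    show "leE S (c (Cell 0 0)) (c Top)" "leE S (c (Cell N N)) (c Top)"
      using N by (auto simp: leE_def adjacent_def)
    show "c (Cell 0 N) \<in> carrier S" "c (Cell N 0) \<in> carrier S" by auto
    show "c (Cell 0 0) = c (Cell 0 N) \<cdot>\<^bsub>S\<^esub> c (Cell N 0)" "c (Cell N N) = c (Cell N 0) \<cdot>\<^bsub>S\<^esub> c (Cell 0 N)"
      by (auto simp: adjacent_def)
  qed
  then show False using N by simp
qed

section \<open>Path semigroups with a missing row\<close>

definition rectangle :: "nat \<Rightarrow> nat set \<Rightarrow> nat set \<Rightarrow> element semigrp" where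
  "rectangle N I L = \<lparr>carrier = insert Zero {Cell i l | i l. i \<in> I \<and> l \<in> L}, smult = pmult N\<rparr>"

lemma rectangle_completely_zero_simple:
  assumes N: "2 \<le> N" and "I \<noteq> {}"
    and row: "\<And>i. i \<in> I \<Longrightarrow> \<exists>l\<in>L. adjacent l i"
    and column: "\<And>l. l \<in> L \<Longrightarrow> \<exists>i\<in>I. adjacent l i"
  shows "completely_zero_simple (rectangle N I L)" (is "completely_zero_simple ?R")
proof -
  have carrier: "carrier ?R = insert Zero {Cell i l | i l. i \<in> I \<and> l \<in> L}"
    and mult [simp]: "x \<cdot>\<^bsub>?R\<^esub> y = pmult N x y" for x y
    by (simp_all add: rectangle_def)
  have semigroup: "is_semigroup ?R"
    by (auto simp: is_semigroup_def carrier pmult_assoc[OF N])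
  obtain i l where il: "i \<in> I" "l \<in> L" "adjacent l i"
    using \<open>I \<noteq> {}\<close> row by blast
  have ideals: "J = {Zero} \<or> J = carrier ?R" if J: "is_ideal ?R J" for J
  proof -
    have sub: "J \<subseteq> carrier ?R" and "J \<noteq> {}"
      and left: "s \<in> carrier ?R \<Longrightarrow> a \<in> J \<Longrightarrow> pmult N s a \<in> J"
      and right: "s \<in> carrier ?R \<Longrightarrow> a \<in> J \<Longrightarrow> pmult N a s \<in> J" for s a
      using J by (auto simp: is_ideal_def)
    have "Zero \<in> J"
      using left[of Zero] \<open>J \<noteq> {}\<close> by (auto simp: carrier)
    show ?thesis
    proof (cases "J = {Zero}")
      case False
      then obtain a where "a \<in> J" "a \<noteq> Zero" using \<open>J \<noteq> {}\<close> by blast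
      then obtain j k where jk: "Cell j k \<in> J" "j \<in> I" "k \<in> L"
        using sub by (auto simp: carrier)
      obtain k' where k': "k' \<in> L" "adjacent k' j" using row jk by blast
      obtain j' where j': "j' \<in> I" "adjacent k j'" using column jk by blast
      have "Cell i' l' \<in> J" if "i' \<in> I" "l' \<in> L" for i' l'
        using left[of "Cell i' k'" "Cell j k"] right[of "Cell j' l'" "Cell i' k"] jk k' j' that
        by (auto simp: carrier)
      then show ?thesis using \<open>Zero \<in> J\<close> sub by (auto simp: carrier)
    qed simp
  qed
  show ?thesis
    unfolding completely_zero_simple_def
  proof (rule conjI[OF semigroup], rule bexI[of _ Zero], intro conjI)
    show "\<forall>J. is_ideal ?R J \<longrightarrow> J = {Zero} \<or> J = carrier ?R" using ideals by blast
    show "\<exists>x\<in>carrier ?R. \<exists>y\<in>carrier ?R. x \<cdot>\<^bsub>?R\<^esub> y \<noteq> Zero"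
      using il by (intro bexI[of _ "Cell i l"]) (auto simp: carrier)
    show "\<exists>e\<in>idempotents ?R. e \<noteq> Zero \<and> (\<forall>f\<in>idempotents ?R. f \<noteq> Zero \<and> leE ?R f e \<longrightarrow> f = e)"
      by (intro bexI[of _ "Cell i l"])
        (use il in \<open>auto simp: idempotents_def carrier leE_def leR_def leL_def split: if_splits\<close>)
  qed (auto simp: carrier)
qed

text \<open>Without row \<open>m\<close> the path consists of the piece of rows and columns less than \<open>m\<close>, which
  contains row and column 0, and the piece that starts with column \<open>m\<close> and contains row and
  column \<open>N\<close>. An idempotent never connects the two pieces, hence neither does an
  element of the core.\<close>

lemma path_without_row_ESR:
  fixes c :: "element \<Rightarrow> 'a"
  assumes c: "inj c" and m: "0 < m" "m < N"
  shows "path_semigroup c N (- {m}) \<in> ESR"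
proof -
  interpret path_rows c N "- {m}"
    by unfold_locales (use c m in auto)
  \<comment> \<open>The cells of \<open>K\<close> have row and column in the same piece.\<close>
  define K where "K = {x \<in> cells (- {m}). \<forall>i l. x = Cell i l \<longrightarrow> (i < m \<longleftrightarrow> l < m)}"
  have K [simp]: "Top \<in> K" "Zero \<in> K" "Cell i l \<in> K \<longleftrightarrow> i \<noteq> m \<and> (i < m \<longleftrightarrow> l < m)" for i l
    by (auto simp: K_def)
  have K_cells: "K \<subseteq> cells (- {m})" by (auto simp: K_def)
  have K_mult: "pmult N x y \<in> K" if "x \<in> K" "y \<in> K" for x y
    using that m by (cases x; cases y) (auto simp: adjacent_def)
  have core: "idem_gen S = c ` K"
  proof (intro equalityI subsetI)
    fix a assume "a \<in> idem_gen S"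
    then show "a \<in> c ` K"
    proof induction
      case (idem e)
      then obtain x where "e = c x" "x \<in> cells (- {m})" "pmult N x x = x"
        by (auto simp: idempotents_path)
      then show ?case by (cases x) (auto simp: adjacent_def split: if_splits)
    qed (auto simp: K_mult)
  next
    fix a assume "a \<in> c ` K"
    then obtain x where x: "x \<in> K" and a: "a = c x" by blast
    show "a \<in> idem_gen S"
    proof (cases x)
      case (Cell i l)
      then show ?thesis
        using x a core_above[of i l] core_below[of l i] by (cases "i \<le> l") auto
    qed (auto simp: a intro: idempotent_in_core)
  qed
  let ?C = "idem_gen_subsemigroup S"
  have C: "carrier ?C = c ` K" "c x \<cdot>\<^bsub>?C\<^esub> c y = c (pmult N x y)" for x y
    by (simp_all add: idem_gen_subsemigroup_def core)
  have regular: "regular_semigroup ?C"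
    unfolding regular_semigroup_def
  proof (intro conjI ballI)
    show "is_semigroup ?C"
      using K(1) by (auto simp: is_semigroup_def C K_mult pmult_assoc[OF N] simp del: K)
  next
    fix a assume "a \<in> carrier ?C"
    then obtain x where a: "a = c x" and x: "x \<in> K" by (auto simp: C)
    have "\<exists>y\<in>K. pmult N (pmult N x y) x = x"
    proof (cases x)
      case (Cell i l)
      then show ?thesis
        by (intro bexI[of _ "Cell (if l = m then Suc l else l) i"])
          (use x in \<open>auto simp: adjacent_def\<close>)
    qed (auto intro: bexI[of _ x] x)
    then show "\<exists>b\<in>carrier ?C. a \<cdot>\<^bsub>?C\<^esub> b \<cdot>\<^bsub>?C\<^esub> a = a" by (auto simp: a C)
  qed
  define I where "I low = {i. i \<noteq> m \<and> (i < m \<longleftrightarrow> low)}" for low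
  define L where "L low = {l. l < m \<longleftrightarrow> low}" for low
  \<comment> \<open>The projection onto a piece annihilates the other one. \<open>Top\<close> goes to the idempotent below it
    in that piece; using both pieces, \<open>Top\<close> is told apart from either of these idempotents.\<close>
  define p where "p low x = (case x of
      Top \<Rightarrow> if low then Cell 0 0 else Cell N N
    | Zero \<Rightarrow> Zero
    | Cell i l \<Rightarrow> if i < m \<longleftrightarrow> low then Cell i l else Zero)" for low x
  let ?R = "\<lambda>low. rectangle N (I low) (L low)"
  have p_carrier: "p low x \<in> carrier (?R low)" if "x \<in> K" for low x
    using that m by (cases x) (auto simp: p_def rectangle_def I_def L_def)
  have p_mult: "p low (pmult N x y) = pmult N (p low x) (p low y)" if "x \<in> K" "y \<in> K" for low x y
    using that m by (cases x; cases y) (auto simp: p_def adjacent_def)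
  have "completely_zero_simple (?R low)" for low
  proof (rule rectangle_completely_zero_simple[OF N])
    show "I low \<noteq> {}" using m by (cases low) (auto simp: I_def)
    show "\<exists>l\<in>L low. adjacent l i" if "i \<in> I low" for i
      using that by (intro bexI[of _ i]) (auto simp: I_def L_def adjacent_def)
    show "\<exists>i\<in>I low. adjacent l i" if "l \<in> L low" for l
      using that by (intro bexI[of _ "if l = m then Suc l else l"]) (auto simp: I_def L_def adjacent_def)
  qed
  moreover have "subdirect_product_of ?C UNIV ?R"
    unfolding subdirect_product_of_def
  proof (intro bexI[of _ "\<lambda>a low. p low (inv c a)"] conjI ballI)
    show "(\<lambda>a low. p low (inv c a)) \<in> semigrp_hom ?C (direct_product UNIV ?R)"
      using p_carrier by (auto simp: semigrp_hom_def direct_product_def C p_mult K_mult)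
        (simp_all add: rectangle_def restrict_def)
    show "inj_on (\<lambda>a low. p low (inv c a)) (carrier ?C)"
    proof (rule inj_onI)
      fix a b assume "a \<in> carrier ?C" "b \<in> carrier ?C"
        and eq: "(\<lambda>low. p low (inv c a)) = (\<lambda>low. p low (inv c b))"
      then obtain x y where "a = c x" "b = c y" "x \<in> K" "y \<in> K" by (auto simp: C)
      then show "a = b"
        using fun_cong[OF eq, of True] fun_cong[OF eq, of False] m
        by (cases x; cases y) (auto simp: p_def split: if_splits)
    qed
    fix low
    show "(\<lambda>a. p low (inv c a)) ` carrier ?C = carrier (?R low)"
    proof (intro equalityI subsetI)
      fix y assume "y \<in> carrier (?R low)"
      then have "y \<in> K" "p low y = y"
        by (auto simp: rectangle_def I_def L_def p_def)
      then show "y \<in> (\<lambda>a. p low (inv c a)) ` carrier ?C"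
        by (intro image_eqI[of _ _ "c y"]) (auto simp: C)
    qed (use p_carrier in \<open>auto simp: C\<close>)
  qed
  ultimately have "strict_regular ?C"
    by (intro strict_regularI[OF regular, of UNIV ?R]) auto
  then show ?thesis by (simp add: ESR_def locally_inverse)
qed

section \<open>Absence of a finite basis\<close>

lemma letters_of_variables: "{l. variable l \<in> V} = Var ` V \<union> Var' ` V"
proof (intro equalityI subsetI)
  fix l assume "l \<in> {l. variable l \<in> V}"
  then show "l \<in> Var ` V \<union> Var' ` V" by (cases l) auto
qed auto

theorem corollary6p8:
  assumes "infinite (UNIV :: 'a set)"
  shows "\<not> (\<exists>B :: bi_identity set. finite B \<and> bi_basis B (ESR :: 'a semigrp set))"
proof
  assume "\<exists>B :: bi_identity set. finite B \<and> bi_basis B (ESR :: 'a semigrp set)"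
  then obtain B :: "bi_identity set" where B: "finite B"
    and ESR: "(ESR :: 'a semigrp set) = {S. locally_inverse S \<and> (\<forall>b\<in>B. satisfies S b)}"
    by (auto simp: bi_basis_def)
  obtain f :: "nat \<Rightarrow> 'a" where "inj f"
    using infinite_countable_subset[OF assms] by blast
  then have "inj (f \<circ> (to_nat :: element \<Rightarrow> nat))"
    by (intro inj_compose) auto
  then obtain c :: "element \<Rightarrow> 'a" where c: "inj c" by blast
  define V where "V = (\<Union>b\<in>B. variables (fst b) \<union> variables (snd b))"
  \<comment> \<open>This leaves \<open>2 * card V + 1\<close> inner rows, one more than the number of letters.\<close>
  define N where "N = 2 * card V + 2"
  have V: "finite V" using B by (auto simp: V_def finite_variables)
  have N: "2 \<le> N" by (simp add: N_def)
  let ?S = "path_semigroup c N UNIV"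
  have S: "locally_inverse ?S"
    by (rule path_rows.locally_inverse) (unfold_locales, use c N in auto)
  have "satisfies ?S b" if b: "b \<in> B" for b
  proof (rule satisfies_locally[OF S])
    fix \<theta> assume \<theta>: "admissible_assignment ?S \<theta>"
    \<comment> \<open>The default 0 for \<open>Top\<close> and \<open>Zero\<close> is harmless, because an inner row is sought.\<close>
    define row where "row a = (case inv c a of Cell i _ \<Rightarrow> i | _ \<Rightarrow> 0)" for a
    let ?W = "{l. variable l \<in> V}"
    have W: "finite ?W" "card ?W \<le> 2 * card V"
      using V card_Un_le[of "Var ` V" "Var' ` V"] card_image_le[of V Var] card_image_le[of V Var']
      by (auto simp: letters_of_variables)
    have "card ((row \<circ> \<theta>) ` ?W) \<le> 2 * card V"
      using card_image_le[OF W(1), of "row \<circ> \<theta>"] W(2) by simp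
    also have "\<dots> < card {1..<N}" by (simp add: N_def)
    finally have "\<not> {1..<N} \<subseteq> (row \<circ> \<theta>) ` ?W"
      using W(1) by (meson card_mono finite_imageI leD)
    then obtain m where "m \<in> {1..<N}" and avoided: "m \<notin> (row \<circ> \<theta>) ` ?W" by blast
    then have m: "0 < m" "m < N" by auto
    let ?T = "path_semigroup c N (- {m})"
    have "?T \<in> ESR" using path_without_row_ESR[OF c] m by blast
    moreover have "\<theta> l \<in> c ` cells (- {m})" if l: "variable l \<in> V" for l
    proof -
      have "\<theta> l \<in> carrier ?S"
        using \<theta> by (cases l) (auto simp: admissible_assignment_def inverses_def)
      then obtain x where x: "\<theta> l = c x" by auto
      have "row (\<theta> l) \<noteq> m" using avoided l by auto
      then have "x \<in> cells (- {m})"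
        using inv_f_f[OF c, of x] by (cases x) (auto simp: x row_def)
      then show ?thesis by (simp only: x imageI)
    qed
    ultimately show "\<exists>A\<subseteq>carrier ?S. locally_inverse (?S\<lparr>carrier := A\<rparr>) \<and>
        satisfies (?S\<lparr>carrier := A\<rparr>) b \<and>
        (\<forall>l. variable l \<in> variables (fst b) \<union> variables (snd b) \<longrightarrow> \<theta> l \<in> A)"
      using b by (intro exI[of _ "c ` cells (- {m})"]) (auto simp: path_semigroup_restrict ESR V_def cells_UNIV)
  qed
  then have "?S \<in> ESR" using S by (simp add: ESR)
  then show False using full_path_not_ESR[OF c N] by blast
qed

end
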